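(* Let $\mathscr{H}$ be a real Hilbert space, let $f:\mathscr{H}\to\mathbb{R}\cup\{+\infty\}$ be closed, convex and proper, let $\rho\in\mathbb{R}$ with $\rho\ne0$, and let $f^*$ be the convex conjugate of $f$. Then for every $\bm{v}\in\mathscr{H}$, $$\bm{v}=\mathbf{Prox}_{f\rho}(\bm{v})+\mathbf{Prox}_{f^*\frac1\rho}(\bm{v}).$$
   Context: For a closed, convex and proper function $h$ on $\mathscr{H}$ and a real $\rho\neq0$, $\mathbf{Prox}_{h\rho}(\bm{v})=\operatorname*{argmin}_{\bm{z}\in\mathscr{H}}\, h(\rho\bm{z})+\frac12\|\bm{z}-\bm{v}\|^2$ (the unique minimizer). The convex conjugate is $f^*(\bm{y})=\sup_{\bm{z}\in\mathscr{H}}\langle\bm{z},\bm{y}\rangle-f(\bm{z})$. *)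

theory Defs
  imports "HOL-Analysis.Analysis"
begin

text \<open>
  Extended-real-valued functions take values in \<^typ>\<open>ereal\<close>; the codomain restriction to the reals
  together with \<open>+\<infinity>\<close> is part of properness. The library's \<open>convex_on\<close> and \<open>epigraph\<close> only cover
  real-valued functions.
\<close>

definition proper_fun :: "('a \<Rightarrow> ereal) \<Rightarrow> bool" where
  "proper_fun f \<longleftrightarrow> (\<forall>x. f x \<noteq> -\<infinity>) \<and> (\<exists>x. f x \<noteq> \<infinity>)"

text \<open>For \<open>u = 0\<close> or \<open>v = 0\<close> this relies on \<open>0 * \<infinity> = 0\<close> in \<^typ>\<open>ereal\<close>, the usual convention.\<close>

definition convex_fun :: "('a::real_vector \<Rightarrow> ereal) \<Rightarrow> bool" where
  "convex_fun f \<longleftrightarrow>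
    (\<forall>x y. \<forall>u\<ge>0. \<forall>v\<ge>0. u + v = 1 \<longrightarrow>
      f (u *\<^sub>R x + v *\<^sub>R y) \<le> ereal u * f x + ereal v * f y)"

definition ext_epigraph :: "('a \<Rightarrow> ereal) \<Rightarrow> ('a \<times> real) set" where
  "ext_epigraph f = {(x, r). f x \<le> ereal r}"

definition closed_fun :: "('a::topological_space \<Rightarrow> ereal) \<Rightarrow> bool" where
  "closed_fun f \<longleftrightarrow> closed (ext_epigraph f)"

definition convex_conjugate :: "('a::real_inner \<Rightarrow> ereal) \<Rightarrow> 'a \<Rightarrow> ereal" where
  "convex_conjugate f y = (SUP z. ereal (z \<bullet> y) - f z)"

text \<open>
  The definite description yields the unique minimizer; if the minimizer did not exist or were not
  unique, the value would be unspecified.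
\<close>

definition Prox :: "('a::real_inner \<Rightarrow> ereal) \<Rightarrow> real \<Rightarrow> 'a \<Rightarrow> 'a" where
  "Prox h \<rho> v =
    (THE z. is_arg_min (\<lambda>z. h (\<rho> *\<^sub>R z) + ereal (1 / 2 * (norm (z - v))\<^sup>2)) (\<lambda>_. True) z)"

end

theory Submission
  imports Defs
begin

text \<open>
  Replacing \<open>f\<close> by \<open>g z = f (\<rho> z)\<close>, whose conjugate is \<open>g* y = f* (y / \<rho>)\<close>, reduces the claim to
  \<open>\<rho> = 1\<close>. The objective \<open>g + \<parallel>\<cdot> - v\<parallel>\<^sup>2 / 2\<close> is bounded below and strongly convex, so its minimizing
  sequences are Cauchy and it attains its minimum at some \<open>p\<close>; there \<open>v - p\<close> is a subgradient of
  \<open>g\<close>. By the equality case of Fenchel--Young, \<open>p\<close> is a subgradient of \<open>g*\<close> at \<open>v - p\<close>, which is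
  the optimality condition for \<open>v - p\<close> in the dual problem. All estimates are made on points
  \<open>(x, r)\<close> of the epigraph, so that they take place in the reals.
\<close>

section \<open>Lower bounds for closed convex functions\<close>

lemma convex_fun_epigraph:
  assumes "convex_fun g" "g x \<le> ereal r" "g y \<le> ereal s" "0 \<le> u" "0 \<le> v" "u + v = 1"
  shows "g (u *\<^sub>R x + v *\<^sub>R y) \<le> ereal (u * r + v * s)"
proof -
  have "g (u *\<^sub>R x + v *\<^sub>R y) \<le> ereal u * g x + ereal v * g y"
    using assms unfolding convex_fun_def by blast
  also have "\<dots> \<le> ereal u * ereal r + ereal v * ereal s"
    using assms by (intro add_mono ereal_mult_left_mono) auto
  finally show ?thesis by simp
qed

lemma proper_fun_obtain_real:
  assumes "proper_fun g"
  obtains x r where "g x = ereal r"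
  using assms unfolding proper_fun_def by (metis ereal_cases)

text \<open>The closed epigraph misses a ball around a point just below it, which bounds
  \<open>g\<close> from below near \<open>x0\<close>. Convexity on the segment from
  \<open>x0\<close> to a distant \<open>x\<close> turns this into a linear rate of decrease. Such a
  cone is enough here, so no separating hyperplane is used.\<close>

lemma closed_convex_proper_lower_bound:
  fixes g :: "'a::real_inner \<Rightarrow> ereal"
  assumes "closed_fun g" "convex_fun g" "proper_fun g"
  shows "\<exists>x0 c K. 0 \<le> K \<and> (\<forall>x r. g x \<le> ereal r \<longrightarrow> c - K * norm (x - x0) \<le> r)"
proof -
  obtain x0 r0 where x0: "g x0 = ereal r0"
    using proper_fun_obtain_real[OF assms(3)] .
  have "open (- ext_epigraph g)" "(x0, r0 - 1) \<in> - ext_epigraph g"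
    using assms(1) x0 by (auto simp: closed_fun_def ext_epigraph_def)
  then obtain e where e: "0 < e" "ball (x0, r0 - 1) e \<subseteq> - ext_epigraph g"
    using open_contains_ball by blast
  \<comment> \<open>Epigraphs are closed upwards: a value of at most \<open>r0 - 1\<close> at
    \<open>y\<close> would put \<open>(y, r0 - 1)\<close> into both the ball and the
    epigraph.\<close>
  have near: "r0 - 1 < s" if "norm (y - x0) < e" "g y \<le> ereal s" for y s
  proof (rule ccontr)
    assume "\<not> r0 - 1 < s"
    then have "g y \<le> ereal (r0 - 1)"
      using that(2) by (meson ereal_less_eq(3) linorder_not_less order_trans)
    moreover have "(y, r0 - 1) \<in> ball (x0, r0 - 1) e"
      using that(1) by (simp add: dist_Pair_Pair dist_norm norm_minus_commute)
    ultimately show False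
      using e(2) by (auto simp: ext_epigraph_def)
  qed
  have "(r0 - 1) - 2 / e * norm (x - x0) \<le> r" if xr: "g x \<le> ereal r" for x r
  proof (cases "norm (x - x0) < e")
    case True
    have "0 \<le> 2 / e * norm (x - x0)" using e(1) by simp
    then show ?thesis using near[OF True xr] by linarith
  next
    case False
    define d where "d = norm (x - x0)"
    \<comment> \<open>With this \<open>t\<close> the point \<open>?y\<close> lies at distance
      \<open>e / 2\<close> from \<open>x0\<close>, where \<open>near\<close> applies.\<close>
    define t where "t = e / (2 * d)"
    have d: "0 < d" "e \<le> d" using False e(1) by (auto simp: d_def)
    have t: "0 < t" "t \<le> 1" "t * d = e / 2" using d e(1) by (auto simp: t_def)
    let ?y = "(1 - t) *\<^sub>R x0 + t *\<^sub>R x"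
    have "?y - x0 = t *\<^sub>R (x - x0)" by (simp add: algebra_simps)
    then have "norm (?y - x0) = t * d" using t(1) by (simp add: d_def)
    then have "norm (?y - x0) < e" using t(3) e(1) by simp
    moreover have "g ?y \<le> ereal ((1 - t) * r0 + t * r)"
      using assms(2) x0 xr t by (intro convex_fun_epigraph) auto
    ultimately have "r0 - 1 < (1 - t) * r0 + t * r" by (rule near)
    then have "- 1 < t * (r - r0)" by (simp add: algebra_simps)
    then have "- 1 / t < r - r0" using t(1) by (simp add: field_simps)
    moreover have "1 / t = 2 / e * d" using d e(1) by (simp add: t_def field_simps)
    ultimately show ?thesis by (simp add: d_def)
  qed
  moreover have "0 \<le> 2 / e" using e(1) by simp
  ultimately show ?thesis by blast
qed

lemma proximal_objective_bounded_below:
  fixes g :: "'a::real_inner \<Rightarrow> ereal"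
  assumes "closed_fun g" "convex_fun g" "proper_fun g"
  shows "\<exists>B. \<forall>x r. g x \<le> ereal r \<longrightarrow> B \<le> r + 1 / 2 * (norm (x - v))\<^sup>2"
proof -
  obtain x0 c K where K: "\<And>x r. g x \<le> ereal r \<Longrightarrow> c - K * norm (x - x0) \<le> r" "0 \<le> K"
    using closed_convex_proper_lower_bound[OF assms] by blast
  \<comment> \<open>The term \<open>- K\<^sup>2 / 2\<close> is the minimum of
    \<open>a\<^sup>2 / 2 - K * a\<close>, taken with \<open>a = norm (x - v)\<close>;
    \<open>K * norm (v - x0)\<close> is the cost of moving the centre from \<open>x0\<close> to
    \<open>v\<close>.\<close>
  have "c - K * norm (v - x0) - K\<^sup>2 / 2 \<le> r + 1 / 2 * (norm (x - v))\<^sup>2"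
    if "g x \<le> ereal r" for x r
  proof -
    have "K * norm (x - x0) \<le> K * (norm (x - v) + norm (v - x0))"
      using K(2) norm_triangle_ineq[of "x - v" "v - x0"] by (intro mult_left_mono) auto
    moreover have "0 \<le> (norm (x - v) - K)\<^sup>2" by simp
    ultimately show ?thesis
      using K(1)[OF that] by (simp add: power2_diff algebra_simps)
  qed
  then show ?thesis by blast
qed

section \<open>Existence of a minimizer\<close>

text \<open>The lower bound \<open>m\<close> is applied at the midpoint, and the parallelogram law
  supplies the gain. Hence points whose objective values barely exceed \<open>m\<close> are close to
  each other.\<close>

lemma proximal_objective_strongly_convex:
  fixes g :: "'a::real_inner \<Rightarrow> ereal"
  assumes "convex_fun g" "g x \<le> ereal r" "g y \<le> ereal s"
    and lower: "\<And>x r. g x \<le> ereal r \<Longrightarrow> m \<le> r + 1 / 2 * (norm (x - v))\<^sup>2"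
  shows "(norm (x - y))\<^sup>2
    \<le> 4 * ((r + 1 / 2 * (norm (x - v))\<^sup>2 - m) + (s + 1 / 2 * (norm (y - v))\<^sup>2 - m))"
proof -
  let ?z = "(1 / 2) *\<^sub>R x + (1 / 2) *\<^sub>R y"
  have "g ?z \<le> ereal (1 / 2 * r + 1 / 2 * s)"
    using assms(1-3) by (intro convex_fun_epigraph) auto
  then have "m \<le> 1 / 2 * r + 1 / 2 * s + 1 / 2 * (norm (?z - v))\<^sup>2"
    by (rule lower)
  moreover have "?z - v = (1 / 2) *\<^sub>R ((x - v) + (y - v))"
    by (simp add: algebra_simps flip: scaleR_add_left)
  then have "(norm (?z - v))\<^sup>2 = 1 / 4 * (norm ((x - v) + (y - v)))\<^sup>2"
    by (simp add: power_mult_distrib power2_eq_square)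
  moreover have "(norm ((x - v) + (y - v)))\<^sup>2 + (norm (x - y))\<^sup>2
      = 2 * (norm (x - v))\<^sup>2 + 2 * (norm (y - v))\<^sup>2"
    unfolding power2_norm_eq_inner by (simp add: inner_commute algebra_simps)
  ultimately show ?thesis
    unfolding right_diff_distrib distrib_left by linarith
qed

lemma proximal_objective_attains_min:
  fixes g :: "'a::{real_inner, complete_space} \<Rightarrow> ereal"
  assumes "closed_fun g" "convex_fun g" "proper_fun g"
  shows "\<exists>p s. g p \<le> ereal s \<and>
    (\<forall>x r. g x \<le> ereal r \<longrightarrow> s + 1 / 2 * (norm (p - v))\<^sup>2 \<le> r + 1 / 2 * (norm (x - v))\<^sup>2)"
proof -
  define q where "q = (\<lambda>(x, r). r + 1 / 2 * (norm (x - v))\<^sup>2)"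
  define m where "m = Inf (q ` ext_epigraph g)"
  obtain B where "\<forall>x r. g x \<le> ereal r \<longrightarrow> B \<le> r + 1 / 2 * (norm (x - v))\<^sup>2"
    using proximal_objective_bounded_below[OF assms] by blast
  then have bdd: "bdd_below (q ` ext_epigraph g)"
    by (intro bdd_belowI[of _ B]) (auto simp: q_def ext_epigraph_def)
  obtain x0 r0 where "g x0 = ereal r0"
    by (rule proper_fun_obtain_real[OF assms(3)])
  then have "(x0, r0) \<in> ext_epigraph g" by (simp add: ext_epigraph_def)
  then have ne: "q ` ext_epigraph g \<noteq> {}" by blast
  have m_le: "m \<le> r + 1 / 2 * (norm (x - v))\<^sup>2" if "g x \<le> ereal r" for x r
  proof -
    have "q (x, r) \<in> q ` ext_epigraph g"
      using that by (auto simp: ext_epigraph_def)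
    then have "m \<le> q (x, r)"
      unfolding m_def using bdd by (rule cInf_lower)
    then show ?thesis by (simp add: q_def)
  qed
  define \<epsilon> where "\<epsilon> n = inverse (real (Suc n))" for n
  have \<epsilon>: "\<epsilon> \<longlonglongrightarrow> 0" "\<And>n. 0 < \<epsilon> n"
    using LIMSEQ_inverse_real_of_nat by (simp_all add: \<epsilon>_def[abs_def])
  have "\<exists>a. a \<in> ext_epigraph g \<and> q a < m + \<epsilon> n" for n
    using cInf_lessD[OF ne, of "m + \<epsilon> n"] \<epsilon>(2)[of n] by (auto simp: m_def)
  then obtain a where a: "\<And>n. a n \<in> ext_epigraph g" "\<And>n. q (a n) < m + \<epsilon> n"
    by metis
  define X where "X n = fst (a n)" for n
  define R where "R n = snd (a n)" for n
  have XR: "g (X n) \<le> ereal (R n)" "R n + 1 / 2 * (norm (X n - v))\<^sup>2 < m + \<epsilon> n" for n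
    using a[of n] by (auto simp: X_def R_def ext_epigraph_def q_def split: prod.splits)
  have dist_X: "(norm (X i - X j))\<^sup>2 \<le> 4 * (\<epsilon> i + \<epsilon> j)" for i j
  proof -
    have "(norm (X i - X j))\<^sup>2 \<le> 4 * ((R i + 1 / 2 * (norm (X i - v))\<^sup>2 - m)
        + (R j + 1 / 2 * (norm (X j - v))\<^sup>2 - m))"
      by (rule proximal_objective_strongly_convex[OF assms(2) XR(1) XR(1)]) (rule m_le)
    then show ?thesis using XR(2)[of i] XR(2)[of j]
      unfolding right_diff_distrib distrib_left by linarith
  qed
  have "Cauchy X"
  proof (rule metric_CauchyI)
    fix e :: real assume "0 < e"
    then have "\<forall>\<^sub>F i in sequentially. \<epsilon> i < e\<^sup>2 / 8"
      by (intro order_tendstoD(2)[OF \<epsilon>(1)]) simp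
    then obtain N where small: "\<And>i. N \<le> i \<Longrightarrow> \<epsilon> i < e\<^sup>2 / 8"
      unfolding eventually_sequentially by blast
    have "dist (X i) (X j) < e" if "N \<le> i" "N \<le> j" for i j
    proof -
      have "(norm (X i - X j))\<^sup>2 < e\<^sup>2"
        using dist_X[of i j] small[OF that(1)] small[OF that(2)]
        unfolding distrib_left by linarith
      then show ?thesis
        using \<open>0 < e\<close> by (simp add: dist_norm power2_less_imp_less)
    qed
    then show "\<exists>N. \<forall>i\<ge>N. \<forall>j\<ge>N. dist (X i) (X j) < e" by blast
  qed
  then obtain p where p: "X \<longlonglongrightarrow> p"
    using Cauchy_convergent_iff convergent_def by blast
  \<comment> \<open>This is the height over \<open>p\<close> at which the objective equals
    \<open>m\<close>.\<close>
  define s where "s = m - 1 / 2 * (norm (p - v))\<^sup>2"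
  \<comment> \<open>The heights \<open>R n\<close> are not known to converge. Raising them to
    \<open>?S n\<close> keeps the points in the epigraph, and \<open>?S n\<close> converges because
    \<open>X\<close> and \<open>\<epsilon>\<close> do.\<close>
  let ?S = "\<lambda>n. m + \<epsilon> n - 1 / 2 * (norm (X n - v))\<^sup>2"
  have "?S \<longlonglongrightarrow> m + 0 - 1 / 2 * (norm (p - v))\<^sup>2"
    by (intro tendsto_intros p \<epsilon>(1))
  then have "(\<lambda>n. (X n, ?S n)) \<longlonglongrightarrow> (p, s)"
    using p by (auto intro: tendsto_Pair simp: s_def)
  moreover have "(X n, ?S n) \<in> ext_epigraph g" for n
  proof -
    have "ereal (R n) \<le> ereal (?S n)" using XR(2)[of n] by simp
    with XR(1) have "g (X n) \<le> ereal (?S n)" by (rule order_trans)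
    then show ?thesis by (simp add: ext_epigraph_def)
  qed
  ultimately have "(p, s) \<in> ext_epigraph g"
    using assms(1) unfolding closed_fun_def
    by (intro closed_sequentially[of "ext_epigraph g" "\<lambda>n. (X n, ?S n)" "(p, s)"])
  then have "g p \<le> ereal s" by (simp add: ext_epigraph_def)
  moreover have "s + 1 / 2 * (norm (p - v))\<^sup>2 = m" by (simp add: s_def)
  ultimately show ?thesis using m_le by (intro exI[of _ p] exI[of _ s]) simp
qed

section \<open>Optimality and subgradients\<close>

text \<open>Minimality is tested at \<open>p + t (x - p)\<close>; after division by \<open>t\<close>
  the quadratic term leaves only a remainder of order \<open>t\<close>, which vanishes as
  \<open>t\<close> tends to 0.\<close>

lemma proximal_min_subgradient:
  fixes g :: "'a::real_inner \<Rightarrow> ereal"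
  assumes "convex_fun g" "g p \<le> ereal s"
    and min: "\<And>x r. g x \<le> ereal r \<Longrightarrow>
      s + 1 / 2 * (norm (p - v))\<^sup>2 \<le> r + 1 / 2 * (norm (x - v))\<^sup>2"
    and "g x \<le> ereal r"
  shows "s + (v - p) \<bullet> (x - p) \<le> r"
proof -
  let ?N = "1 / 2 * (norm (x - p))\<^sup>2"
  have le: "s + (v - p) \<bullet> (x - p) \<le> r + t * ?N" if t: "0 < t" "t \<le> 1" for t
  proof -
    let ?y = "(1 - t) *\<^sub>R p + t *\<^sub>R x"
    have "g ?y \<le> ereal ((1 - t) * s + t * r)"
      using assms t by (intro convex_fun_epigraph) auto
    from min[OF this]
    have *: "s + 1 / 2 * (norm (p - v))\<^sup>2 \<le> (1 - t) * s + t * r + 1 / 2 * (norm (?y - v))\<^sup>2" .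
    have y: "?y - v = (p - v) + t *\<^sub>R (x - p)" by (simp add: algebra_simps)
    have "(norm (?y - v))\<^sup>2
        = (norm (p - v))\<^sup>2 + 2 * t * ((p - v) \<bullet> (x - p)) + t * t * (norm (x - p))\<^sup>2"
      unfolding y power2_norm_eq_inner
      by (simp add: inner_add_left inner_add_right inner_commute algebra_simps)
    moreover have "(p - v) \<bullet> (x - p) = - ((v - p) \<bullet> (x - p))"
      by (simp add: inner_diff_left)
    ultimately have "t * (s + (v - p) \<bullet> (x - p)) \<le> t * (r + t * ?N)"
      using * by (simp add: algebra_simps)
    then show ?thesis using t(1) by simp
  qed
  have "((\<lambda>t. r + t * ?N) \<longlongrightarrow> r + 0 * ?N) (at_right 0)"
    by (intro tendsto_intros)
  moreover have "\<forall>\<^sub>F t in at_right 0. s + (v - p) \<bullet> (x - p) \<le> r + t * ?N"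
    unfolding eventually_at_right_field using le by (intro exI[of _ 1]) auto
  ultimately have "s + (v - p) \<bullet> (x - p) \<le> r + 0 * ?N"
    by (rule tendsto_lowerbound) simp
  then show ?thesis by simp
qed

text \<open>Expanding the square shows that the objective at \<open>x\<close> exceeds that at
  \<open>p\<close> by at least half the squared distance, so \<open>p\<close> is the only minimizer.
  A single subgradient inequality is required, so the criterion serves the conjugate as directly as
  \<open>f\<close>.\<close>

lemma Prox_eqI:
  fixes h :: "'a::real_inner \<Rightarrow> ereal"
  assumes p: "h (\<rho> *\<^sub>R p) = ereal s"
    and sub: "\<And>x. ereal (s + (v - p) \<bullet> (x - p)) \<le> h (\<rho> *\<^sub>R x)"
  shows "Prox h \<rho> v = p"
proof -
  define F where "F = (\<lambda>z. h (\<rho> *\<^sub>R z) + ereal (1 / 2 * (norm (z - v))\<^sup>2))"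
  have Fp: "F p = ereal (s + 1 / 2 * (norm (p - v))\<^sup>2)"
    by (simp add: F_def p)
  have F: "F p + ereal (1 / 2 * (norm (x - p))\<^sup>2) \<le> F x" for x
  proof -
    have y: "x - v = (x - p) - (v - p)" by simp
    have "(norm (x - v))\<^sup>2 = (norm (x - p))\<^sup>2 - 2 * ((v - p) \<bullet> (x - p)) + (norm (p - v))\<^sup>2"
      unfolding y norm_minus_commute[of p v] power2_norm_eq_inner
      by (simp add: inner_diff_left inner_diff_right inner_commute algebra_simps)
    then have "F p + ereal (1 / 2 * (norm (x - p))\<^sup>2)
        = ereal (s + (v - p) \<bullet> (x - p)) + ereal (1 / 2 * (norm (x - v))\<^sup>2)"
      by (simp add: Fp algebra_simps)
    also have "\<dots> \<le> F x"
      unfolding F_def using sub by (intro add_mono) auto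
    finally show ?thesis .
  qed
  have less: "F p < F x" if "x \<noteq> p" for x
  proof -
    have "F p < F p + ereal (1 / 2 * (norm (x - p))\<^sup>2)"
      using that by (simp add: Fp)
    then show ?thesis using F[of x] by (rule less_le_trans)
  qed
  have "is_arg_min F (\<lambda>_. True) z \<longleftrightarrow> z = p" for z
    unfolding is_arg_min_def using less by (cases "z = p") (auto dest: less_asym)
  then show ?thesis
    unfolding Prox_def F_def[symmetric] by (intro the_equality) simp_all
qed

section \<open>Rescaling the argument\<close>

lemma convex_fun_scaleR:
  assumes "convex_fun f"
  shows "convex_fun (\<lambda>z. f (c *\<^sub>R z))"
  unfolding convex_fun_def
proof (intro allI impI)
  fix x y and u v :: real
  assume "0 \<le> u" "0 \<le> v" "u + v = 1"
  then have "f (u *\<^sub>R (c *\<^sub>R x) + v *\<^sub>R (c *\<^sub>R y)) \<le> ereal u * f (c *\<^sub>R x) + ereal v * f (c *\<^sub>R y)"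
    using assms unfolding convex_fun_def by blast
  then show "f (c *\<^sub>R (u *\<^sub>R x + v *\<^sub>R y)) \<le> ereal u * f (c *\<^sub>R x) + ereal v * f (c *\<^sub>R y)"
    by (simp add: scaleR_add_right mult.commute)
qed

lemma closed_fun_scaleR:
  fixes f :: "'a::real_normed_vector \<Rightarrow> ereal"
  assumes "closed_fun f"
  shows "closed_fun (\<lambda>z. f (c *\<^sub>R z))"
proof -
  have "ext_epigraph (\<lambda>z. f (c *\<^sub>R z)) = (\<lambda>a. (c *\<^sub>R fst a, snd a)) -` ext_epigraph f"
    by (auto simp: ext_epigraph_def)
  then show ?thesis
    using assms unfolding closed_fun_def by (auto intro!: closed_vimage continuous_intros)
qed

lemma proper_fun_scaleR:
  fixes f :: "'a::real_vector \<Rightarrow> ereal"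
  assumes "proper_fun f" "c \<noteq> 0"
  shows "proper_fun (\<lambda>z. f (c *\<^sub>R z))"
proof -
  obtain x where "f x \<noteq> \<infinity>" using assms(1) unfolding proper_fun_def by blast
  then have "f (c *\<^sub>R ((1 / c) *\<^sub>R x)) \<noteq> \<infinity>" using assms(2) by simp
  then show ?thesis using assms(1) unfolding proper_fun_def by blast
qed

section \<open>The decomposition\<close>

theorem mainTheorem5:
  fixes f :: "'a::{real_inner, complete_space} \<Rightarrow> ereal" and \<rho> :: real
  assumes "closed_fun f" and "convex_fun f" and "proper_fun f"
    and "\<rho> \<noteq> 0"
  shows "\<forall>v. v = Prox f \<rho> v + Prox (convex_conjugate f) (1 / \<rho>) v"
proof
  fix v :: 'a
  let ?g = "\<lambda>z. f (\<rho> *\<^sub>R z)"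
  have g: "closed_fun ?g" "convex_fun ?g" "proper_fun ?g"
    using assms by (simp_all add: closed_fun_scaleR convex_fun_scaleR proper_fun_scaleR)
  obtain p s where ps: "?g p \<le> ereal s"
    and min: "\<And>x r. ?g x \<le> ereal r \<Longrightarrow>
      s + 1 / 2 * (norm (p - v))\<^sup>2 \<le> r + 1 / 2 * (norm (x - v))\<^sup>2"
    using proximal_objective_attains_min[OF g] by blast
  have sub: "ereal (s + (v - p) \<bullet> (x - p)) \<le> ?g x" for x
  proof (cases "?g x")
    case (real r)
    then show ?thesis
      using proximal_min_subgradient[OF g(2) ps min, of x r] by simp
  next
    case MInf
    then show ?thesis using g(3) by (auto simp: proper_fun_def)
  qed simp
  \<comment> \<open>So far \<open>s\<close> is only a height above \<open>p\<close>; the subgradient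
    inequality at \<open>p\<close> itself makes it the value.\<close>
  have gp: "?g p = ereal s"
    using sub[of p] ps by (simp add: antisym)
  have "Prox f \<rho> v = p"
    using gp sub by (rule Prox_eqI)
  moreover have "Prox (convex_conjugate f) (1 / \<rho>) v = v - p"
  proof (rule Prox_eqI)
    \<comment> \<open>The subgradient inequality at \<open>z / \<rho>\<close> bounds every term of
      the supremum, and \<open>z = \<rho> p\<close> attains the bound: equality in
      Fenchel--Young.\<close>
    have "ereal (z \<bullet> ((1 / \<rho>) *\<^sub>R (v - p))) - f z \<le> ereal (p \<bullet> (v - p) - s)" for z
    proof -
      have z: "\<rho> *\<^sub>R ((1 / \<rho>) *\<^sub>R z) = z" using assms(4) by simp
      have "ereal (s + (v - p) \<bullet> ((1 / \<rho>) *\<^sub>R z - p)) \<le> f z"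
        using sub[of "(1 / \<rho>) *\<^sub>R z"] unfolding z .
      then show ?thesis
        by (cases "f z") (auto simp: inner_diff_right inner_commute algebra_simps)
    qed
    moreover have "ereal ((\<rho> *\<^sub>R p) \<bullet> ((1 / \<rho>) *\<^sub>R (v - p))) - f (\<rho> *\<^sub>R p) = ereal (p \<bullet> (v - p) - s)"
      using gp assms(4) by simp
    ultimately show "convex_conjugate f ((1 / \<rho>) *\<^sub>R (v - p)) = ereal (p \<bullet> (v - p) - s)"
      unfolding convex_conjugate_def by (intro antisym SUP_least SUP_upper2[of "\<rho> *\<^sub>R p"]) auto
  next
    fix y
    \<comment> \<open>The left side collapses to \<open>p \<bullet> y - s\<close>, the term of the
      supremum at \<open>\<rho> p\<close>, since the factors \<open>\<rho>\<close> and
      \<open>1 / \<rho>\<close> cancel.\<close>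
    have "ereal (p \<bullet> (v - p) - s + (v - (v - p)) \<bullet> (y - (v - p)))
        = ereal ((\<rho> *\<^sub>R p) \<bullet> ((1 / \<rho>) *\<^sub>R y)) - f (\<rho> *\<^sub>R p)"
      using gp assms(4) by (simp add: inner_diff_right)
    also have "\<dots> \<le> convex_conjugate f ((1 / \<rho>) *\<^sub>R y)"
      unfolding convex_conjugate_def by (rule SUP_upper) simp
    finally show "ereal (p \<bullet> (v - p) - s + (v - (v - p)) \<bullet> (y - (v - p)))
        \<le> convex_conjugate f ((1 / \<rho>) *\<^sub>R y)" .
  qed
  ultimately show "v = Prox f \<rho> v + Prox (convex_conjugate f) (1 / \<rho>) v"
    by simp
qed

end
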